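(* Let $X$ be a real reflexive Banach space, let $F\colon X\to X^*$ be (single-valued, everywhere defined) maximal monotone, strictly monotone, 3*-monotone and surjective, and let $A\colon X\rightrightarrows X^*$ be monotone. Then $A$ is maximal monotone if and only if $\operatorname{ran}(A+F)=X^*$.
   Context: $X^*$ is the dual of $X$ with pairing $\langle\cdot,\cdot\rangle$. For set-valued $A\colon X\rightrightarrows X^*$: graph, domain, range as usual; monotone means $\langle x-y,x^*-y^*\rangle\ge0$ for all $(x,x^* ),(y,y^* )\in\operatorname{gra}A$; maximal monotone means no proper monotone extension of the graph. $(A+F)x=Ax+Fx$ for $x\in\operatorname{dom}A$. $F$ strictly monotone: $\langle x-y,Fx-Fy\rangle>0$ whenever $x\neq y$. $F$ is 3*-monotone: for every $(x,x^* )\in X\times X^*$, $\sup_{y\in X}\langle x-y,Fy-x^*\rangle<+\infty$. *)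

theory Defs
  imports "HOL-Analysis.Analysis"
begin

text \<open>The dual space of a real normed space X is modelled as the type of bounded
  linear functionals X \<Rightarrow>L real; the pairing is function application.
  A set-valued operator X to X* is a function into sets of functionals.\<close>

definition reflexive_space :: "'a::real_normed_vector itself \<Rightarrow> bool" where
  "reflexive_space _ \<longleftrightarrow>
     (\<forall>\<phi> :: ('a \<Rightarrow>\<^sub>L real) \<Rightarrow>\<^sub>L real. \<exists>x::'a. \<forall>f. blinfun_apply \<phi> f = blinfun_apply f x)"

definition graph_op :: "('a::real_normed_vector \<Rightarrow> ('a \<Rightarrow>\<^sub>L real) set) \<Rightarrow> ('a \<times> ('a \<Rightarrow>\<^sub>L real)) set" where
  "graph_op A = {(x, x'). x' \<in> A x}"

definition dom_op :: "('a::real_normed_vector \<Rightarrow> ('a \<Rightarrow>\<^sub>L real) set) \<Rightarrow> 'a set" where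
  "dom_op A = {x. A x \<noteq> {}}"

definition ran_op :: "('a::real_normed_vector \<Rightarrow> ('a \<Rightarrow>\<^sub>L real) set) \<Rightarrow> ('a \<Rightarrow>\<^sub>L real) set" where
  "ran_op A = (\<Union>x. A x)"

definition monotone_op :: "('a::real_normed_vector \<Rightarrow> ('a \<Rightarrow>\<^sub>L real) set) \<Rightarrow> bool" where
  "monotone_op A \<longleftrightarrow>
     (\<forall>x x' y y'. (x, x') \<in> graph_op A \<longrightarrow> (y, y') \<in> graph_op A \<longrightarrow>
        blinfun_apply (x' - y') (x - y) \<ge> 0)"

definition maximal_monotone_op :: "('a::real_normed_vector \<Rightarrow> ('a \<Rightarrow>\<^sub>L real) set) \<Rightarrow> bool" where
  "maximal_monotone_op A \<longleftrightarrow> monotone_op A \<and>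
     (\<forall>B. monotone_op B \<longrightarrow> graph_op A \<subseteq> graph_op B \<longrightarrow> graph_op B = graph_op A)"

definition sum_op :: "('a::real_normed_vector \<Rightarrow> ('a \<Rightarrow>\<^sub>L real) set) \<Rightarrow> ('a \<Rightarrow> ('a \<Rightarrow>\<^sub>L real)) \<Rightarrow> 'a \<Rightarrow> ('a \<Rightarrow>\<^sub>L real) set" where
  "sum_op A F x = {a + F x | a. a \<in> A x}"

definition strictly_monotone_fun :: "('a::real_normed_vector \<Rightarrow> ('a \<Rightarrow>\<^sub>L real)) \<Rightarrow> bool" where
  "strictly_monotone_fun F \<longleftrightarrow> (\<forall>x y. x \<noteq> y \<longrightarrow> blinfun_apply (F x - F y) (x - y) > 0)"

definition three_star_monotone :: "('a::real_normed_vector \<Rightarrow> ('a \<Rightarrow>\<^sub>L real)) \<Rightarrow> bool" where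
  "three_star_monotone F \<longleftrightarrow>
     (\<forall>x x'. \<exists>M::real. \<forall>y. blinfun_apply (F y - x') (x - y) \<le> M)"

end

theory Submission
  imports Defs
begin

text \<open>If \<open>ran (A + F)\<close> is everything and \<open>(v, v')\<close> is monotonically related to \<open>A\<close>, solve
  \<open>v' + F v \<in> (A + F) a\<close>; strict monotonicity forces \<open>a = v\<close>. Conversely, let \<open>f\<close> be the Fitzpatrick
  function of \<open>A\<close> and \<open>g(x, x') = \<Phi>(x, w - x') - w x\<close> with \<open>\<Phi>\<close> the Fitzpatrick function of \<open>F\<close>.
  Maximality gives \<open>f(x, x') \<ge> x' x\<close> and \<open>g(x, x') \<ge> - x' x\<close>, so \<open>f + g \<ge> 0\<close>. As \<open>F\<close> is 3*-monotone,
  \<open>g\<close> is finite everywhere, hence bounded above on a ball by Baire's theorem, and the sandwich theorem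
  yields a continuous linear \<open>L\<close> with \<open>L z - g z \<le> f c + L c\<close>. By reflexivity \<open>- L\<close> is given by a pair
  \<open>(v, v')\<close>, and the inequality, restricted to the graphs, makes \<open>(v, v')\<close> and \<open>(v, w - v')\<close>
  monotonically related to \<open>A\<close> and \<open>F\<close>. Maximality then gives \<open>v' \<in> A v\<close> and \<open>w - v' = F v\<close>.\<close>

section \<open>Hahn--Banach and the sandwich theorem\<close>

text \<open>Positive homogeneity is encoded by one inequality for \<open>t > 0\<close>; applying it
  with \<open>1/t\<close> returns the other, so constructions such as infima have only one direction
  to check.\<close>

definition sublinear :: "('a::real_vector \<Rightarrow> real) \<Rightarrow> bool" where
  "sublinear S \<longleftrightarrow> (\<forall>x y. S (x + y) \<le> S x + S y) \<and> (\<forall>t>0. \<forall>x. S (t *\<^sub>R x) \<le> t * S x)"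

lemma sublinear_add: "sublinear S \<Longrightarrow> S (x + y) \<le> S x + S y"
  by (simp add: sublinear_def)

lemma sublinear_scaleR:
  assumes "sublinear S" "t > 0"
  shows "S (t *\<^sub>R x) = t * S x"
proof (rule antisym)
  show "S (t *\<^sub>R x) \<le> t * S x"
    using assms by (simp add: sublinear_def)
  have "S ((1/t) *\<^sub>R (t *\<^sub>R x)) \<le> (1/t) * S (t *\<^sub>R x)"
    using assms unfolding sublinear_def by (metis zero_less_divide_1_iff)
  then show "t * S x \<le> S (t *\<^sub>R x)"
    using assms(2) by (simp add: field_simps)
qed

lemma sublinear_0: "sublinear S \<Longrightarrow> S 0 = 0"
  using sublinear_scaleR[of S 2 0] by simp

lemma sublinear_lower: "sublinear S \<Longrightarrow> - S (- x) \<le> S x"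
  using sublinear_add[of S x "- x"] sublinear_0[of S] by simp

text \<open>Subadditivity survives the infimum because the smaller of two chain members,
  \<open>V\<close>, lies below both: \<open>V (x + y)\<close> is at most \<open>V x + V y\<close>,
  hence at most \<open>T x + U y\<close>.\<close>

lemma sublinear_INF_chain:
  assumes "C \<noteq> {}"
    and sub: "\<And>T. T \<in> C \<Longrightarrow> sublinear T"
    and chain: "\<And>T U. T \<in> C \<Longrightarrow> U \<in> C \<Longrightarrow> T \<le> U \<or> U \<le> T"
    and bdd: "\<And>x. bdd_below ((\<lambda>T. T x) ` C)"
  shows "sublinear (\<lambda>x. INF T\<in>C. T x)"
  unfolding sublinear_def
proof (intro conjI allI impI)
  fix x y
  let ?m = "\<lambda>x. INF T\<in>C. T x"
  have *: "?m (x + y) \<le> T x + U y" if TU: "T \<in> C" "U \<in> C" for T U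
  proof -
    obtain V where V: "V \<in> C" "V \<le> T" "V \<le> U"
      using chain[OF TU] TU by blast
    have "?m (x + y) \<le> V (x + y)"
      using V bdd by (intro cINF_lower)
    also have "\<dots> \<le> V x + V y"
      by (intro sublinear_add sub V)
    also have "\<dots> \<le> T x + U y"
      using V by (intro add_mono) (auto simp: le_fun_def)
    finally show ?thesis .
  qed
  have "?m (x + y) - U y \<le> ?m x" if "U \<in> C" for U
    using *[OF _ that] by (intro cINF_greatest assms) (simp add: algebra_simps)
  then have "?m (x + y) - ?m x \<le> ?m y"
    by (intro cINF_greatest assms) (force simp: algebra_simps)
  then show "?m (x + y) \<le> ?m x + ?m y"
    by simp
next
  fix t :: real and x
  assume "t > 0"
  have "(INF T\<in>C. T (t *\<^sub>R x)) \<le> t * T x" if "T \<in> C" for T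
    using cINF_lower[OF bdd that, of "t *\<^sub>R x"] sublinear_scaleR[OF sub[OF that] \<open>t > 0\<close>] by simp
  then have "(INF T\<in>C. T (t *\<^sub>R x)) / t \<le> (INF T\<in>C. T x)"
    using \<open>t > 0\<close> by (intro cINF_greatest assms) (simp add: field_simps)
  then show "(INF T\<in>C. T (t *\<^sub>R x)) \<le> t * (INF T\<in>C. T x)"
    using \<open>t > 0\<close> by (simp add: field_simps)
qed

text \<open>An odd sublinear function is linear, since subadditivity at \<open>x, y\<close> and at
  \<open>- x, - y\<close> gives both inequalities. Minimality supplies oddness: it forces
  \<open>n = m\<close>, while \<open>n (- y)\<close> is at most \<open>- m y\<close>.\<close>

lemma linear_if_minimal_sublinear:
  assumes m: "sublinear m"
    and min: "\<And>T. sublinear T \<Longrightarrow> (\<And>x. T x \<le> m x) \<Longrightarrow> T = m"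
  shows "linear m"
proof -
  have odd: "m (- y) = - m y" for y
  proof -
    \<comment> \<open>the directional derivative of \<open>m\<close> at infinity along \<open>y\<close> is a sublinear minorant that is linear on the line through \<open>y\<close>\<close>
    define n where "n x = (INF t\<in>{0..}. m (x + t *\<^sub>R y) - t * m y)" for x
    have bdd: "bdd_below ((\<lambda>t. m (x + t *\<^sub>R y) - t * m y) ` {0..})" for x
    proof (rule bdd_belowI2)
      fix t :: real assume "t \<in> {0..}"
      then have "m (t *\<^sub>R y) = t * m y"
        using sublinear_scaleR[OF m, of t y] sublinear_0[OF m] by (cases "t = 0") auto
      then show "- m (- x) \<le> m (x + t *\<^sub>R y) - t * m y"
        using sublinear_add[OF m, of "x + t *\<^sub>R y" "- x"] by simp
    qed
    have n_le: "n x \<le> m (x + t *\<^sub>R y) - t * m y" if "t \<ge> 0" for x t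
      unfolding n_def using that by (intro cINF_lower bdd) simp
    have "sublinear n"
      unfolding sublinear_def
    proof (intro conjI allI impI)
      fix x z
      have *: "n (x + z) \<le> (m (x + s *\<^sub>R y) - s * m y) + (m (z + t *\<^sub>R y) - t * m y)"
        if "s \<ge> 0" "t \<ge> 0" for s t
        using n_le[of "s + t" "x + z"] that
          sublinear_add[OF m, of "x + s *\<^sub>R y" "z + t *\<^sub>R y"]
        by (simp add: algebra_simps)
      have "n (x + z) - (m (z + t *\<^sub>R y) - t * m y) \<le> n x" if "t \<ge> 0" for t
        unfolding n_def[of x] using *[OF _ that] by (intro cINF_greatest) (auto simp: algebra_simps)
      then have "n (x + z) - n x \<le> n z"
        unfolding n_def[of z] by (intro cINF_greatest) (force simp: algebra_simps)+
      then show "n (x + z) \<le> n x + n z"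
        by simp
    next
      fix s :: real and x
      assume s: "s > 0"
      have "n (s *\<^sub>R x) \<le> s * (m (x + t *\<^sub>R y) - t * m y)" if "t \<ge> 0" for t
        using n_le[of "s * t" "s *\<^sub>R x"] that s sublinear_scaleR[OF m s, of "x + t *\<^sub>R y"]
        by (simp add: algebra_simps)
      then have "n (s *\<^sub>R x) / s \<le> n x"
        unfolding n_def[of x] using s by (intro cINF_greatest) (auto simp: field_simps)
      then show "n (s *\<^sub>R x) \<le> s * n x"
        using s by (simp add: field_simps)
    qed
    then have "n = m"
      using n_le[of 0] by (intro min) auto
    then have "m (- y) \<le> - m y"
      using n_le[of 1 "- y"] sublinear_0[OF m] by simp
    then show ?thesis
      using sublinear_lower[OF m, of y] by simp
  qed
  show ?thesis
  proof (rule linearI)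
    fix x y
    show "m (x + y) = m x + m y"
      using sublinear_add[OF m, of x y] sublinear_add[OF m, of "- x" "- y"] odd[of x] odd[of y]
        odd[of "x + y"] by simp
  next
    fix t x
    show "m (t *\<^sub>R x) = t *\<^sub>R m x"
      using sublinear_scaleR[OF m, of t x] sublinear_scaleR[OF m, of "- t" x] odd[of "t *\<^sub>R x"]
        sublinear_0[OF m] by (cases t "0::real" rule: linorder_cases) auto
  qed
qed

text \<open>Instead of extending functionals from subspaces, Zorn's lemma is applied to the
  sublinear minorants of \<open>S\<close>; a minimal one is linear.\<close>

theorem hahn_banach_sublinear:
  assumes S: "sublinear S"
  obtains L where "linear L" "\<And>x. L x \<le> S x"
proof -
  define A where "A = {T. sublinear T \<and> T \<le> S}"
  have "\<exists>m\<in>A. \<forall>T\<in>A. T \<le> m \<longrightarrow> T = m"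
  proof (rule predicate_Zorn)
    \<comment> \<open>The order is reversed, so that a maximal element is a minimal minorant and a
      chain is bounded by its pointwise infimum.\<close>
    show "partial_order_on A (relation_of (\<lambda>T U. U \<le> T) A)"
      by (rule partial_order_on_relation_ofI) auto
    fix C assume "C \<in> Chains (relation_of (\<lambda>T U. U \<le> T) A)"
    then have CA: "C \<subseteq> A" and chain: "\<And>T U. T \<in> C \<Longrightarrow> U \<in> C \<Longrightarrow> T \<le> U \<or> U \<le> T"
      unfolding Chains_def relation_of_def by blast+
    show "\<exists>U\<in>A. \<forall>T\<in>C. U \<le> T"
    proof (cases "C = {}")
      case True
      then show ?thesis using S by (auto simp: A_def)
    next
      case False
      have bdd: "bdd_below ((\<lambda>T. T x) ` C)" for x
      proof (rule bdd_belowI2)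
        fix T assume "T \<in> C"
        then have "sublinear T" "T (- x) \<le> S (- x)"
          using CA by (auto simp: A_def le_fun_def)
        then show "- S (- x) \<le> T x"
          using sublinear_lower[of T x] by simp
      qed
      have sub: "sublinear (\<lambda>x. INF T\<in>C. T x)"
        using CA by (intro sublinear_INF_chain False bdd chain) (auto simp: A_def)
      have le: "(\<lambda>x. INF T\<in>C. T x) \<le> T" if "T \<in> C" for T
        using that by (auto simp: le_fun_def intro: cINF_lower bdd)
      then show ?thesis
        using sub False CA by (intro bexI[of _ "\<lambda>x. INF T\<in>C. T x"]) (force simp: A_def)+
    qed
  qed
  then obtain m where m: "m \<in> A" and min: "\<And>T. T \<in> A \<Longrightarrow> T \<le> m \<Longrightarrow> T = m"
    by blast
  have "linear m"
  proof (rule linear_if_minimal_sublinear)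
    show "sublinear m"
      using m by (simp add: A_def)
    fix T assume "sublinear T" "\<And>x. T x \<le> m x"
    moreover from this have "T \<le> m" "T \<le> S"
      using m by (auto simp: A_def le_fun_def intro: order_trans)
    ultimately show "T = m"
      by (intro min) (auto simp: A_def)
  qed
  moreover have "m x \<le> S x" for x
    using m by (auto simp: A_def le_fun_def)
  ultimately show thesis
    using that by blast
qed

text \<open>Convexity with unnormalised weights, multiplied by \<open>s + t\<close>: the form in
  which difference quotients with different steps are combined.\<close>

lemma convex_on_weighted_mean:
  fixes f :: "'a::real_vector \<Rightarrow> real"
  assumes f: "convex_on C f" and cd: "c \<in> C" "d \<in> C" and pos: "s > 0" "t > 0"
  shows "(s + t) * f ((s *\<^sub>R c + t *\<^sub>R d) /\<^sub>R (s + t)) \<le> s * f c + t * f d" (is ?le)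
    and "(s *\<^sub>R c + t *\<^sub>R d) /\<^sub>R (s + t) \<in> C" (is ?mem)
proof -
  have eq: "(s *\<^sub>R c + t *\<^sub>R d) /\<^sub>R (s + t) = (s / (s + t)) *\<^sub>R c + (t / (s + t)) *\<^sub>R d"
    by (simp add: scaleR_add_right divide_inverse mult.commute)
  have st: "s / (s + t) \<ge> 0" "t / (s + t) \<ge> 0" "s / (s + t) + t / (s + t) = 1"
    using pos by (auto simp: add_divide_distrib[symmetric])
  show ?mem
    unfolding eq using f st cd unfolding convex_on_def convex_def by blast
  have "f ((s *\<^sub>R c + t *\<^sub>R d) /\<^sub>R (s + t)) \<le> s / (s + t) * f c + t / (s + t) * f d"
    unfolding eq using f st cd unfolding convex_on_def by blast
  also have "\<dots> = (s * f c + t * f d) / (s + t)"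
    by (simp add: add_divide_distrib)
  finally show ?le
    using pos by (simp add: field_simps)
qed

text \<open>The infimum \<open>S\<close> of the quotients \<open>(g (c + t x) + f c) / t\<close> is
  sublinear. A linear minorant \<open>L\<close> of \<open>S\<close>, taken at \<open>z - c\<close>
  with step \<open>t = 1\<close>, gives the claim.\<close>

theorem sandwich_linear:
  fixes f g :: "'a::real_vector \<Rightarrow> real"
  assumes f: "convex_on C f" and "C \<noteq> {}"
    and g: "convex_on UNIV g"
    and ge: "\<And>c. c \<in> C \<Longrightarrow> f c + g c \<ge> 0"
  obtains L where "linear L" "\<And>z c. c \<in> C \<Longrightarrow> L z - g z \<le> f c + L c"
proof -
  define Q where "Q x = (\<lambda>(t, c). (g (c + t *\<^sub>R x) + f c) / t)" for x
  define I :: "(real \<times> 'a) set" where "I = {0<..} \<times> C"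
  define S where "S x = (INF p\<in>I. Q x p)" for x
  have I: "I \<noteq> {}"
    using \<open>C \<noteq> {}\<close> by (auto simp: I_def intro: exI[of _ "1::real"])
  obtain c0 where c0: "c0 \<in> C"
    using \<open>C \<noteq> {}\<close> by blast
  note convex_quot = convex_on_weighted_mean[OF f]
  have g_quot: "(s + t) * g ((s *\<^sub>R c + t *\<^sub>R d) /\<^sub>R (s + t)) \<le> s * g c + t * g d"
    if "s > 0" "t > 0" for s t c d
    using convex_on_weighted_mean(1)[OF g _ _ that] by simp
  have bdd: "bdd_below (Q x ` I)" for x
  proof (rule bdd_belowI2)
    fix p assume "p \<in> I"
    then obtain t c where p: "p = (t, c)" and t: "t > 0" and c: "c \<in> C"
      by (auto simp: I_def)
    \<comment> \<open>\<open>?e\<close> is a mean of \<open>c\<close> and \<open>c0\<close>, and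
      with the same weights a mean of \<open>c + t x\<close> and \<open>c0 - x\<close>. Hence
      \<open>ge\<close> at \<open>?e\<close> yields a bound free of \<open>t\<close> and
      \<open>c\<close>.\<close>
    let ?e = "(1 *\<^sub>R c + t *\<^sub>R c0) /\<^sub>R (1 + t)"
    have e: "?e \<in> C" "(1 + t) * f ?e \<le> 1 * f c + t * f c0"
      using convex_quot[of c c0 1 t] c c0 t by auto
    have "?e = (1 *\<^sub>R (c + t *\<^sub>R x) + t *\<^sub>R (c0 - x)) /\<^sub>R (1 + t)"
      by (simp add: algebra_simps)
    then have "(1 + t) * g ?e \<le> 1 * g (c + t *\<^sub>R x) + t * g (c0 - x)"
      using g_quot[of 1 t "c + t *\<^sub>R x" "c0 - x"] t by (simp only: zero_less_one)
    moreover have "0 \<le> (1 + t) * (f ?e + g ?e)"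
      using ge[OF e(1)] t by simp
    ultimately have "0 \<le> g (c + t *\<^sub>R x) + f c + t * (g (c0 - x) + f c0)"
      using e(2) by (simp add: algebra_simps)
    then show "- (g (c0 - x) + f c0) \<le> Q x p"
      using t by (simp add: p Q_def field_simps)
  qed
  have S_le: "S x \<le> (g (c + t *\<^sub>R x) + f c) / t" if "t > 0" "c \<in> C" for x t c
    using cINF_lower[OF bdd, of "(t, c)" x] that by (simp add: S_def I_def Q_def)
  have S_ge: "b \<le> S x" if "\<And>t c. t > 0 \<Longrightarrow> c \<in> C \<Longrightarrow> b \<le> (g (c + t *\<^sub>R x) + f c) / t" for b x
    unfolding S_def using I that by (intro cINF_greatest) (auto simp: I_def Q_def)
  have "sublinear S"
    unfolding sublinear_def
  proof (intro conjI allI impI)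
    fix x y
    have *: "S (x + y) \<le> (g (c + s *\<^sub>R x) + f c) / s + (g (d + t *\<^sub>R y) + f d) / t"
      if st: "s > 0" "t > 0" and cd: "c \<in> C" "d \<in> C" for s t c d
    proof -
      \<comment> \<open>the difference quotients with steps \<open>s\<close> and \<open>t\<close> combine to one with the harmonic step \<open>r\<close>\<close>
      define r where "r = s * t / (s + t)"
      have r: "r > 0" "1 / r = 1 / s + 1 / t"
        using st by (auto simp: r_def field_simps)
      let ?e = "(t *\<^sub>R c + s *\<^sub>R d) /\<^sub>R (t + s)"
      have e: "?e \<in> C" "(t + s) * f ?e \<le> t * f c + s * f d"
        using convex_quot[of c d t s] st cd by auto
      have "?e + r *\<^sub>R (x + y) = (t *\<^sub>R (c + s *\<^sub>R x) + s *\<^sub>R (d + t *\<^sub>R y)) /\<^sub>R (t + s)"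
        by (simp add: r_def algebra_simps divide_inverse)
      then have "(t + s) * g (?e + r *\<^sub>R (x + y)) \<le> t * g (c + s *\<^sub>R x) + s * g (d + t *\<^sub>R y)"
        using g_quot[of t s "c + s *\<^sub>R x" "d + t *\<^sub>R y"] st by simp
      then have "(t + s) * (g (?e + r *\<^sub>R (x + y)) + f ?e)
          \<le> t * (g (c + s *\<^sub>R x) + f c) + s * (g (d + t *\<^sub>R y) + f d)"
        using e(2) by (simp add: algebra_simps)
      then have "(t + s) * (g (?e + r *\<^sub>R (x + y)) + f ?e) / (s * t)
          \<le> (t * (g (c + s *\<^sub>R x) + f c) + s * (g (d + t *\<^sub>R y) + f d)) / (s * t)"
        using st by (intro divide_right_mono) auto
      also have "\<dots> = (g (c + s *\<^sub>R x) + f c) / s + (g (d + t *\<^sub>R y) + f d) / t"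
        using st by (simp add: add_divide_distrib)
      also have "(t + s) * (g (?e + r *\<^sub>R (x + y)) + f ?e) / (s * t) = (g (?e + r *\<^sub>R (x + y)) + f ?e) / r"
        using st by (simp add: r_def add.commute mult.commute)
      finally show ?thesis
        using S_le[OF r(1) e(1), of "x + y"] by linarith
    qed
    have "S (x + y) - (g (d + t *\<^sub>R y) + f d) / t \<le> S x" if "t > 0" "d \<in> C" for t d
    proof (rule S_ge)
      fix s :: real and c assume "s > 0" "c \<in> C"
      then show "S (x + y) - (g (d + t *\<^sub>R y) + f d) / t \<le> (g (c + s *\<^sub>R x) + f c) / s"
        using *[of s t c d] that by linarith
    qed
    then have "S (x + y) - S x \<le> S y"
      by (intro S_ge) (simp add: algebra_simps)
    then show "S (x + y) \<le> S x + S y"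
      by simp
  next
    fix s :: real and x
    assume s: "s > 0"
    have "S (s *\<^sub>R x) / s \<le> S x"
    proof (rule S_ge)
      fix t :: real and c assume tc: "t > 0" "c \<in> C"
      then have "S (s *\<^sub>R x) \<le> (g (c + t *\<^sub>R x) + f c) / (t / s)"
        using S_le[of "t / s" c "s *\<^sub>R x"] s by simp
      then show "S (s *\<^sub>R x) / s \<le> (g (c + t *\<^sub>R x) + f c) / t"
        using s tc by (simp add: field_simps)
    qed
    then show "S (s *\<^sub>R x) \<le> s * S x"
      using s by (simp add: field_simps)
  qed
  then obtain L where L: "linear L" "\<And>x. L x \<le> S x"
    by (rule hahn_banach_sublinear) blast
  have "L z - g z \<le> f c + L c" if "c \<in> C" for z c
    using L(2)[of "z - c"] S_le[of 1 c "z - c"] that linear_diff[OF L(1), of z c] by simp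
  with L(1) show thesis
    using that by blast
qed

section \<open>Suprema of families of functions\<close>

text \<open>A real-valued supremum is meaningful only where the family is bounded above. This set
  serves as effective domain, and one estimate shows both its convexity and that of the
  supremum.\<close>

lemma convex_on_SUP:
  fixes h :: "'i \<Rightarrow> 'a::real_vector \<Rightarrow> real"
  assumes "I \<noteq> {}" and h: "\<And>i. i \<in> I \<Longrightarrow> convex_on UNIV (h i)"
  shows "convex_on {x. bdd_above ((\<lambda>i. h i x) ` I)} (\<lambda>x. SUP i\<in>I. h i x)"
proof -
  have *: "h i (u *\<^sub>R x + v *\<^sub>R y) \<le> u * (SUP i\<in>I. h i x) + v * (SUP i\<in>I. h i y)"
    if "i \<in> I" "bdd_above ((\<lambda>i. h i x) ` I)" "bdd_above ((\<lambda>i. h i y) ` I)"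
      "u \<ge> 0" "v \<ge> 0" "u + v = 1" for i u v x y
  proof -
    have "h i (u *\<^sub>R x + v *\<^sub>R y) \<le> u * h i x + v * h i y"
      using h[OF that(1)] that unfolding convex_on_def by blast
    also have "\<dots> \<le> u * (SUP i\<in>I. h i x) + v * (SUP i\<in>I. h i y)"
      using that by (intro add_mono mult_left_mono cSUP_upper) auto
    finally show ?thesis .
  qed
  show ?thesis
    unfolding convex_on_def convex_def
  proof (intro conjI ballI allI impI)
    fix x y and u v :: real
    assume xy: "x \<in> {x. bdd_above ((\<lambda>i. h i x) ` I)}" "y \<in> {x. bdd_above ((\<lambda>i. h i x) ` I)}"
      and uv: "u \<ge> 0" "v \<ge> 0" "u + v = 1"
    have "bdd_above ((\<lambda>i. h i (u *\<^sub>R x + v *\<^sub>R y)) ` I)"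
      using * xy uv by (intro bdd_aboveI2) auto
    then show "u *\<^sub>R x + v *\<^sub>R y \<in> {x. bdd_above ((\<lambda>i. h i x) ` I)}"
      by simp
    show "(SUP i\<in>I. h i (u *\<^sub>R x + v *\<^sub>R y)) \<le> u * (SUP i\<in>I. h i x) + v * (SUP i\<in>I. h i y)"
      using * xy uv \<open>I \<noteq> {}\<close> by (intro cSUP_least) auto
  qed
qed

text \<open>A one-sided uniform boundedness principle: the closed sets \<open>E n\<close> cover the
  space, so by Baire one of them contains a ball.\<close>

lemma pointwise_bdd_above_imp_bounded_on_ball:
  fixes h :: "'i \<Rightarrow> 'a::complete_space \<Rightarrow> real"
  assumes cont: "\<And>i. i \<in> I \<Longrightarrow> continuous_on UNIV (h i)"
    and bdd: "\<And>x. bdd_above ((\<lambda>i. h i x) ` I)"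
  obtains x0 r M where "r > 0" "\<And>x i. dist x0 x < r \<Longrightarrow> i \<in> I \<Longrightarrow> h i x \<le> M"
proof -
  define E where "E n = {x. \<forall>i\<in>I. h i x \<le> real n}" for n
  have closed: "closed (E n)" for n
  proof -
    have "E n = (\<Inter>i\<in>I. {x. h i x \<le> real n})"
      by (auto simp: E_def)
    then show ?thesis
      using cont by (auto intro!: closed_INT closed_Collect_le continuous_on_const)
  qed
  have cover: "(\<Union>n. E n) = UNIV"
  proof -
    have "\<exists>n. x \<in> E n" for x
    proof -
      obtain M where "\<And>i. i \<in> I \<Longrightarrow> h i x \<le> M"
        using bdd[of x] by (auto simp: bdd_above_def)
      moreover obtain n where "M \<le> real n"
        using real_arch_simple by blast
      ultimately show ?thesis
        by (auto simp: E_def intro: order_trans)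
    qed
    then show ?thesis by blast
  qed
  have "\<exists>n. interior (E n) \<noteq> {}"
  proof (rule ccontr)
    assume "\<not> ?thesis"
    then have "Met_TC.mtopology interior_of \<Union>(range E) = {}"
      using closed by (intro Met_TC.metric_Baire_category_alt) (auto simp: complete_UNIV)
    then show False
      by (simp add: cover)
  qed
  then obtain n x0 where "x0 \<in> interior (E n)"
    by blast
  then obtain r where "r > 0" "ball x0 r \<subseteq> E n"
    by (auto simp: mem_interior)
  then show thesis
    by (intro that[of r x0 "real n"]) (auto simp: E_def subset_iff)
qed

text \<open>The ball contains \<open>x0 + k x\<close> together with \<open>x0 - k x\<close>, so the
  bound from above controls \<open>L x\<close> with both signs.\<close>

lemma bounded_linear_if_bounded_above_on_ball:
  fixes L :: "'a::real_normed_vector \<Rightarrow> real"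
  assumes L: "linear L" and "r > 0" and le: "\<And>x. dist x0 x < r \<Longrightarrow> L x \<le> M"
  shows "bounded_linear L"
proof (rule bounded_linear_intro)
  fix x
  show "norm (L x) \<le> norm x * ((M - L x0) * 2 / r)"
  proof (cases "x = 0")
    case True
    then show ?thesis using linear_0[OF L] by simp
  next
    case False
    define k where "k = r / (2 * norm x)"
    have k: "k > 0"
      using False \<open>r > 0\<close> by (simp add: k_def)
    have small: "norm (k *\<^sub>R x) < r"
      using False \<open>r > 0\<close> by (simp add: k_def)
    have "L (x0 + k *\<^sub>R x) \<le> M" "L (x0 - k *\<^sub>R x) \<le> M"
      using small by (auto intro!: le simp: dist_norm)
    then have "k * \<bar>L x\<bar> \<le> M - L x0"
      using k by (auto simp: linear_add[OF L] linear_diff[OF L] linear_scale[OF L] abs_if)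
    then have "\<bar>L x\<bar> \<le> (M - L x0) / k"
      using k by (simp add: field_simps)
    then show ?thesis
      by (simp add: k_def field_simps)
  qed
qed (auto simp: linear_add[OF L] linear_scale[OF L])

section \<open>Maximal monotone operators\<close>

lemma monotone_op_insert:
  assumes "monotone_op A"
    and rel: "\<And>a a'. a' \<in> A a \<Longrightarrow> 0 \<le> blinfun_apply (a' - v') (a - v)"
  shows "monotone_op (A(v := insert v' (A v)))"
proof -
  have rel': "0 \<le> blinfun_apply (v' - a') (v - a)" if "a' \<in> A a" for a a'
    using rel[OF that] by (simp add: blinfun.bilinear_simps)
  show ?thesis
    using assms(1) rel rel' unfolding monotone_op_def graph_op_def
    by (auto split: if_splits)
qed

text \<open>Adjoining the pair keeps the operator monotone, and maximality forbids the graph to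
  grow.\<close>

lemma maximal_monotone_op_memI:
  assumes "maximal_monotone_op A"
    and "\<And>a a'. a' \<in> A a \<Longrightarrow> 0 \<le> blinfun_apply (a' - v') (a - v)"
  shows "v' \<in> A v"
proof -
  let ?B = "A(v := insert v' (A v))"
  have "monotone_op ?B"
    using assms by (intro monotone_op_insert) (auto simp: maximal_monotone_op_def)
  moreover have "graph_op A \<subseteq> graph_op ?B"
    by (auto simp: graph_op_def)
  ultimately have "graph_op ?B = graph_op A"
    using assms(1) unfolding maximal_monotone_op_def by blast
  moreover have "(v, v') \<in> graph_op ?B"
    by (simp add: graph_op_def)
  ultimately show ?thesis
    by (simp add: graph_op_def)
qed

lemma maximal_monotone_opI:
  assumes "monotone_op A"
    and "\<And>v v'. (\<And>a a'. a' \<in> A a \<Longrightarrow> 0 \<le> blinfun_apply (a' - v') (a - v)) \<Longrightarrow> v' \<in> A v"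
  shows "maximal_monotone_op A"
  unfolding maximal_monotone_op_def
proof (intro conjI allI impI equalityI subrelI)
  fix B v v'
  assume B: "monotone_op B" "graph_op A \<subseteq> graph_op B" and v: "(v, v') \<in> graph_op B"
  have "v' \<in> A v"
  proof (rule assms(2))
    fix a a' assume "a' \<in> A a"
    then have "(a, a') \<in> graph_op B"
      using B(2) by (auto simp: graph_op_def)
    then show "0 \<le> blinfun_apply (a' - v') (a - v)"
      using B(1) v unfolding monotone_op_def by blast
  qed
  then show "(v, v') \<in> graph_op A"
    by (simp add: graph_op_def)
qed (use assms(1) in auto)

lemma maximal_monotone_if_surj_sum:
  assumes F: "strictly_monotone_fun F" and A: "monotone_op A"
    and ran: "ran_op (sum_op A F) = UNIV"
  shows "maximal_monotone_op A"
proof (rule maximal_monotone_opI[OF A])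
  fix v v'
  assume rel: "\<And>a a'. a' \<in> A a \<Longrightarrow> 0 \<le> blinfun_apply (a' - v') (a - v)"
  have "v' + F v \<in> ran_op (sum_op A F)"
    by (simp add: ran)
  then obtain a a' where a: "a' \<in> A a" "v' + F v = a' + F a"
    by (auto simp: ran_op_def sum_op_def)
  \<comment> \<open>Being related to \<open>A\<close> now gives the sign opposite to the one that
    strict monotonicity demands for distinct points.\<close>
  have eq: "a' - v' = - (F a - F v)"
    using a(2) by (simp add: algebra_simps)
  have "blinfun_apply (F a - F v) (a - v) \<le> 0"
    using rel[OF a(1)] unfolding eq by (simp add: blinfun.bilinear_simps)
  then have "a = v"
    using F unfolding strictly_monotone_fun_def by (metis not_less)
  then show "v' \<in> A v"
    using a by simp
qed

text \<open>The supremum over \<open>p\<close> in the graph is the Fitzpatrick function at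
  \<open>q\<close>. Each member of the family is affine in \<open>q\<close>.\<close>

definition fitz :: "'a::real_normed_vector \<times> ('a \<Rightarrow>\<^sub>L real) \<Rightarrow> 'a \<times> ('a \<Rightarrow>\<^sub>L real) \<Rightarrow> real" where
  "fitz p q = blinfun_apply (snd p) (fst q) + blinfun_apply (snd q) (fst p)
     - blinfun_apply (snd p) (fst p)"

lemma fitz_eq:
  "fitz (a, a') (x, x') = blinfun_apply x' x - blinfun_apply (a' - x') (a - x)"
  by (simp add: fitz_def blinfun.bilinear_simps)

lemma fitz_affine:
  assumes "u + v = 1"
  shows "fitz p (u *\<^sub>R q + v *\<^sub>R r) = u * fitz p q + v * fitz p r"
proof -
  have v: "v = 1 - u" using assms by simp
  show ?thesis
    unfolding v by (simp add: fitz_def blinfun.bilinear_simps algebra_simps)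
qed

text \<open>With an empty graph, \<open>(0, 0)\<close> would be vacuously related to it and hence
  belong to it.\<close>

lemma maximal_monotone_op_nonempty:
  assumes "maximal_monotone_op A"
  shows "graph_op A \<noteq> {}"
  using maximal_monotone_op_memI[OF assms, of 0 0] by (auto simp: graph_op_def)

text \<open>Were the supremum smaller, \<open>(x, x')\<close> would be strictly related to every
  pair of the graph, hence belong to the graph and be strictly related to itself.\<close>

lemma maximal_monotone_SUP_fitz_ge:
  assumes A: "maximal_monotone_op A" and bdd: "bdd_above ((\<lambda>p. fitz p (x, x')) ` graph_op A)"
  shows "blinfun_apply x' x \<le> (SUP p\<in>graph_op A. fitz p (x, x'))"
proof (rule ccontr)
  assume "\<not> ?thesis"
  then have less: "fitz p (x, x') < blinfun_apply x' x" if "p \<in> graph_op A" for p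
    using cSUP_upper[OF that bdd] by linarith
  have rel: "0 < blinfun_apply (a' - x') (a - x)" if "a' \<in> A a" for a a'
    using less[of "(a, a')"] that by (simp add: fitz_eq graph_op_def)
  then have "x' \<in> A x"
    by (intro maximal_monotone_op_memI[OF A] less_imp_le)
  from rel[OF this] show False by simp
qed

text \<open>\<open>L\<close> splits along the two factors; its part on the dual is an element of the
  bidual, which reflexivity represents by a point \<open>v\<close>.\<close>

lemma reflexive_functional_on_prod:
  fixes L :: "'a::real_normed_vector \<times> ('a \<Rightarrow>\<^sub>L real) \<Rightarrow> real"
  assumes refl: "reflexive_space TYPE('a)" and L: "bounded_linear L"
  obtains u v where "\<And>x x'. L (x, x') = blinfun_apply u x + blinfun_apply x' v"
proof -
  have "bounded_linear (\<lambda>x::'a. L (x, 0))" "bounded_linear (\<lambda>x'. L (0::'a, x'))"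
    by (auto intro!: bounded_linear_compose[OF L] bounded_linear_Pair bounded_linear_ident bounded_linear_zero)
  then obtain u \<phi> where u: "\<And>x. blinfun_apply u x = L (x, 0)"
    and \<phi>: "\<And>x'. blinfun_apply \<phi> x' = L (0, x')"
    by (metis bounded_linear_Blinfun_apply)
  obtain v where v: "\<And>x'. blinfun_apply \<phi> x' = blinfun_apply x' v"
    using refl unfolding reflexive_space_def by blast
  have "L (x, x') = blinfun_apply u x + blinfun_apply x' v" for x x'
    using linear_add[OF bounded_linear.linear[OF L], of "(x, 0)" "(0, x')"] u \<phi> v by simp
  then show thesis
    using that by blast
qed

lemma surj_sum_if_maximal_monotone:
  fixes F :: "'a::banach \<Rightarrow> ('a \<Rightarrow>\<^sub>L real)"
  assumes refl: "reflexive_space TYPE('a)"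
    and F: "maximal_monotone_op (\<lambda>x. {F x})"
    and star: "three_star_monotone F"
    and A: "maximal_monotone_op A"
  shows "\<exists>v. w - F v \<in> A v"
proof -
  define D where "D = {q. bdd_above ((\<lambda>p. fitz p q) ` graph_op A)}"
  define f where "f q = (SUP p\<in>graph_op A. fitz p q)" for q
  \<comment> \<open>The reflection of \<open>x'\<close> to \<open>w - x'\<close> encodes the
    equation to solve: \<open>x'\<close> in \<open>A x\<close> together with
    \<open>w - x' = F x\<close>.\<close>
  define h where "h y q = fitz (y, F y) (fst q, w - snd q) - blinfun_apply w (fst q)" for y q
  define g where "g q = (SUP y. h y q)" for q
  have h_eq: "h y (x, x') = - blinfun_apply x' x - blinfun_apply (F y - (w - x')) (y - x)" for y x x'
    by (simp add: h_def fitz_eq blinfun.bilinear_simps)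
  have A_mono: "monotone_op A"
    using A by (simp add: maximal_monotone_op_def)
  have F_mono: "0 \<le> blinfun_apply (F y - F x) (y - x)" for x y
    using F unfolding maximal_monotone_op_def monotone_op_def graph_op_def by auto
  have f_conv: "convex_on D f"
    unfolding D_def f_def
    by (intro convex_on_SUP maximal_monotone_op_nonempty A)
      (auto simp: convex_on_def fitz_affine)
  have f_graph: "q \<in> D" "f q \<le> blinfun_apply (snd q) (fst q)" if "q \<in> graph_op A" for q
  proof -
    have le: "fitz p q \<le> blinfun_apply (snd q) (fst q)" if "p \<in> graph_op A" for p
    proof -
      have "0 \<le> blinfun_apply (snd p - snd q) (fst p - fst q)"
        using A_mono that \<open>q \<in> graph_op A\<close> unfolding monotone_op_def by (metis prod.collapse)
      then show ?thesis
        using fitz_eq[of "fst p" "snd p" "fst q" "snd q"] by simp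
    qed
    then show "q \<in> D"
      using bdd_aboveI2[OF le] by (simp add: D_def)
    show "f q \<le> blinfun_apply (snd q) (fst q)"
      unfolding f_def using that le by (intro cSUP_least) auto
  qed
  have D: "D \<noteq> {}"
    using f_graph(1) maximal_monotone_op_nonempty[OF A] by blast
  have h_conv: "convex_on UNIV (h y)" for y
  proof -
    have "h y (u *\<^sub>R q + v *\<^sub>R r) = u * h y q + v * h y r" if "u + v = 1" for u v q r
    proof -
      have v: "v = 1 - u" using that by simp
      show ?thesis
        unfolding v by (simp add: h_def fitz_def blinfun.bilinear_simps algebra_simps)
    qed
    then show ?thesis
      by (simp add: convex_on_def)
  qed
  have h_cont: "continuous_on UNIV (h y)" for y
    unfolding h_def fitz_def by (auto intro!: continuous_intros)
  have h_bdd: "bdd_above (range (\<lambda>y. h y q))" for q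
  proof -
    obtain x x' where q: "q = (x, x')"
      by fastforce
    \<comment> \<open>3*-monotonicity is used at the pair \<open>(x, w - x')\<close>; it makes
      \<open>g\<close> finite everywhere.\<close>
    obtain M where M: "\<And>y. blinfun_apply (F y - (w - x')) (x - y) \<le> M"
      using star unfolding three_star_monotone_def by blast
    have "h y q \<le> M - blinfun_apply x' x" for y
      using M[of y] by (simp add: q h_eq blinfun.bilinear_simps)
    then show ?thesis
      by (rule bdd_aboveI2)
  qed
  have h_le: "h y q \<le> g q" for y q
    unfolding g_def by (intro cSUP_upper h_bdd) simp
  have g_conv: "convex_on UNIV g"
    using convex_on_SUP[of UNIV h] h_conv h_bdd by (simp add: g_def[abs_def])
  have fg: "f q + g q \<ge> 0" if qD: "q \<in> D" for q
  proof -
    obtain x x' where q: "q = (x, x')"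
      by fastforce
    have "- blinfun_apply x' x \<le> g q"
    proof (rule ccontr)
      assume "\<not> ?thesis"
      then have rel: "0 < blinfun_apply (F y - (w - x')) (y - x)" for y
        using h_le[of y q] by (simp add: q h_eq)
      then have "w - x' \<in> {F x}"
        by (intro maximal_monotone_op_memI[OF F]) (simp add: less_imp_le)
      then show False
        using rel[of x] by simp
    qed
    moreover have "blinfun_apply x' x \<le> f q"
      using maximal_monotone_SUP_fitz_ge[OF A] qD by (auto simp: D_def f_def q)
    ultimately show ?thesis
      by simp
  qed
  obtain L where L: "linear L" "\<And>z c. c \<in> D \<Longrightarrow> L z - g z \<le> f c + L c"
    using sandwich_linear[OF f_conv D g_conv fg] by blast
  obtain c0 where c0: "c0 \<in> D"
    using D by blast
  obtain x0 r M where r: "r > 0" and M: "\<And>q y. dist x0 q < r \<Longrightarrow> h y q \<le> M"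
    using pointwise_bdd_above_imp_bounded_on_ball[of UNIV h] h_cont h_bdd by (metis UNIV_I)
  have "bounded_linear L"
  proof (rule bounded_linear_if_bounded_above_on_ball[OF L(1) r])
    fix q assume "dist x0 q < r"
    then have "g q \<le> M"
      unfolding g_def by (intro cSUP_least M) auto
    then show "L q \<le> f c0 + L c0 + M"
      using L(2)[OF c0, of q] by simp
  qed
  \<comment> \<open>The solution pair will be \<open>(- v, - u)\<close>, with \<open>w + u\<close>
    as the value of \<open>F\<close> at \<open>- v\<close>.\<close>
  then obtain u v where uv: "\<And>x x'. L (x, x') = blinfun_apply u x + blinfun_apply x' v"
    using reflexive_functional_on_prod[OF refl] by blast
  \<comment> \<open>the choice \<open>z = (y, w - F y)\<close> makes both Fitzpatrick functions explicit; in each of the two uses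
    below one side of the inequality vanishes\<close>
  have gap: "- blinfun_apply (F y - (w + u)) (y + v) \<le> blinfun_apply (a' + u) (a + v)"
    if "a' \<in> A a" for a a' y
  proof -
    have aD: "(a, a') \<in> graph_op A"
      using that by (simp add: graph_op_def)
    \<comment> \<open>The reflected pair \<open>(y, F y)\<close> lies on the graph of
      \<open>F\<close>, so by monotonicity the last term in \<open>h_eq\<close> only lowers the
      value.\<close>
    have "g (y, w - F y) \<le> - blinfun_apply (w - F y) y"
      unfolding g_def using F_mono by (intro cSUP_least) (auto simp: h_eq)
    then show ?thesis
      using f_graph(2)[OF aD] L(2)[OF f_graph(1)[OF aD], of "(y, w - F y)"]
      by (simp add: uv blinfun.bilinear_simps)
  qed
  have "- u \<in> A (- v)"
  proof (rule maximal_monotone_op_memI[OF A])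
    fix a a' assume "a' \<in> A a"
    then show "0 \<le> blinfun_apply (a' - - u) (a - - v)"
      using gap[of a' a "- v"] by simp
  qed
  \<comment> \<open>The membership just proved allows \<open>a = - v\<close> and
    \<open>a' = - u\<close> in \<open>gap\<close>, which makes its right side zero.\<close>
  have "w + u \<in> {F (- v)}"
  proof (rule maximal_monotone_op_memI[OF F])
    fix y y' assume "y' \<in> {F y}"
    then show "0 \<le> blinfun_apply (y' - (w + u)) (y - - v)"
      using gap[OF \<open>- u \<in> A (- v)\<close>, of y] by simp
  qed
  then have "F (- v) = w + u"
    by simp
  then have "w - F (- v) = - u"
    by simp
  with \<open>- u \<in> A (- v)\<close> show ?thesis
    by metis
qed

theorem theorem2p3:
  fixes F :: "'a::banach \<Rightarrow> ('a \<Rightarrow>\<^sub>L real)"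
    and A :: "'a \<Rightarrow> ('a \<Rightarrow>\<^sub>L real) set"
  assumes "reflexive_space TYPE('a)"
    and "maximal_monotone_op (\<lambda>x. {F x})"
    and "strictly_monotone_fun F"
    and "three_star_monotone F"
    and "surj F"
    and "monotone_op A"
  shows "maximal_monotone_op A \<longleftrightarrow> ran_op (sum_op A F) = UNIV"
proof
  assume A: "maximal_monotone_op A"
  have "w \<in> ran_op (sum_op A F)" for w
  proof -
    obtain v where "w - F v \<in> A v"
      using surj_sum_if_maximal_monotone[OF assms(1,2,4) A] by blast
    then have "w \<in> sum_op A F v"
      unfolding sum_op_def by (force intro: exI[of _ "w - F v"])
    then show ?thesis
      by (auto simp: ran_op_def)
  qed
  then show "ran_op (sum_op A F) = UNIV"
    by blast
next
  assume "ran_op (sum_op A F) = UNIV"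
  then show "maximal_monotone_op A"
    by (rule maximal_monotone_if_surj_sum[OF assms(3,6)])
qed

end
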